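(* Let $S=(S_t)_{t\ge0}$ be a subordinator without drift whose Lévy measure has a density $\nu$ on $(0,\infty)$, and suppose there is a constant $T_0\in[0,\infty)$ such that $\liminf_{x\to0}x\nu(x)=1/T_0$, with the convention $1/0=\infty$. Then for all $t>T_0$, the transition density $p(t,x)$ of $S_t$ exists and is a continuous bounded function of $x$ on $(0,\infty)$.
   Context: A subordinator is a non-decreasing Lévy process on $\mathbb R$ with $S_0=0$; without drift means $\mathbb E e^{-\lambda S_t}=e^{-t\phi(\lambda)}$ with $\phi(\lambda)=\int_0^\infty(1-e^{-\lambda s})\nu(s)\,ds$, where $\nu\ge0$ and $\int_0^\infty\min\{1,s\}\nu(s)ds<\infty$. The transition density $p(t,\cdot)$ is the density of the law of $S_t$ with respect to Lebesgue measure. *)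

theory Defs
  imports "HOL-Probability.Probability"
begin

text \<open>The process is indexed by real times, but only its values at times \<open>t \<ge> 0\<close> matter.
  Path properties hold almost surely.\<close>

locale levy_process = prob_space M for M :: "'a measure" +
  fixes S :: "real \<Rightarrow> 'a \<Rightarrow> real"
  assumes measurable_process: "\<And>t. 0 \<le> t \<Longrightarrow> random_variable borel (S t)"
    and start_zero: "AE \<omega> in M. S 0 \<omega> = 0"
    and independent_increments:
      "\<And>n (\<tau> :: nat \<Rightarrow> real). 0 \<le> \<tau> 0 \<Longrightarrow> (\<And>i. i < n \<Longrightarrow> \<tau> i < \<tau> (Suc i)) \<Longrightarrow>
         indep_vars (\<lambda>_. borel) (\<lambda>i \<omega>. S (\<tau> (Suc i)) \<omega> - S (\<tau> i) \<omega>) {..<n}"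
    and stationary_increments:
      "\<And>s t. 0 \<le> s \<Longrightarrow> 0 \<le> t \<Longrightarrow>
         distr M borel (\<lambda>\<omega>. S (s + t) \<omega> - S s \<omega>) = distr M borel (S t)"
    and stochastically_continuous:
      "\<And>t \<epsilon>. 0 \<le> t \<Longrightarrow> 0 < \<epsilon> \<Longrightarrow>
         ((\<lambda>s. prob {\<omega> \<in> space M. \<epsilon> < \<bar>S s \<omega> - S t \<omega>\<bar>}) \<longlongrightarrow> 0) (at t within {0..})"
    and right_continuous_paths:
      "AE \<omega> in M. \<forall>t\<ge>0. ((\<lambda>s. S s \<omega>) \<longlongrightarrow> S t \<omega>) (at_right t)"
    and left_limits_paths:
      "AE \<omega> in M. \<forall>t>0. \<exists>l. ((\<lambda>s. S s \<omega>) \<longlongrightarrow> l) (at_left t)"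

locale subordinator = levy_process +
  assumes nondecreasing_paths: "AE \<omega> in M. mono_on {0..} (\<lambda>t. S t \<omega>)"

text \<open>Integrability of \<open>min 1 s * \<nu> s\<close> over \<open>(0, \<infinity>)\<close> includes Borel measurability of \<open>\<nu>\<close> there.\<close>

definition levy_density :: "(real \<Rightarrow> real) \<Rightarrow> bool" where
  "levy_density \<nu> \<longleftrightarrow>
     (\<forall>s>0. 0 \<le> \<nu> s) \<and> set_integrable lborel {0<..} (\<lambda>s. min 1 s * \<nu> s)"

definition laplace_exponent :: "(real \<Rightarrow> real) \<Rightarrow> real \<Rightarrow> real" where
  "laplace_exponent \<nu> l = (LINT s:{0<..}|lborel. (1 - exp (- l * s)) * \<nu> s)"

definition driftless_with_levy_density ::
    "'a measure \<Rightarrow> (real \<Rightarrow> 'a \<Rightarrow> real) \<Rightarrow> (real \<Rightarrow> real) \<Rightarrow> bool" where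
  "driftless_with_levy_density M S \<nu> \<longleftrightarrow>
     levy_density \<nu> \<and>
     (\<forall>t\<ge>0. \<forall>l\<ge>0. (LINT \<omega>|M. exp (- l * S t \<omega>)) = exp (- t * laplace_exponent \<nu> l))"

definition law_density :: "'a measure \<Rightarrow> ('a \<Rightarrow> real) \<Rightarrow> (real \<Rightarrow> real) \<Rightarrow> bool" where
  "law_density M X f \<longleftrightarrow> (\<forall>x. 0 \<le> f x) \<and> distributed M lborel X (\<lambda>x. ennreal (f x))"

end

theory Submission
  imports Defs "HOL-Complex_Analysis.Complex_Analysis"
begin

text \<open>The Laplace transform of \<open>S\<^sub>t\<close> and \<open>exp (- t \<phi>)\<close> extend holomorphically to the right
  half-plane and continuously to the imaginary axis, so their agreement on the positive reals gives
  \<open>\<bar>E exp (i u S\<^sub>t)\<bar> = exp (- t \<integral> (1 - cos (u s)) \<nu>(s) ds)\<close>. If \<open>s \<nu>(s) \<ge> c\<close> near \<open>0\<close>, the integral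
  is at least \<open>c ln \<bar>u\<bar> - O(1)\<close>, and the characteristic function is \<open>O(\<bar>u\<bar> powr (- t c))\<close>.
  For \<open>t > T0\<close> one can choose \<open>c\<close> with \<open>t c > 1\<close>; then the characteristic function is
  integrable and Fourier inversion yields the density.\<close>

text \<open>Dominated convergence for the difference quotients: the Lipschitz bound at
  \<open>x\<close> makes \<open>w\<close> a majorant of all of them. The field is left general
  because both holomorphy in a complex parameter and the derivative of a real distribution function
  are needed.\<close>

lemma has_field_derivative_integral:
  fixes f :: "'b :: {real_normed_field, banach, second_countable_topology} \<Rightarrow> 'a \<Rightarrow> 'b"
  assumes S: "open S" "x \<in> S"
    and int: "\<And>y. y \<in> S \<Longrightarrow> integrable N (f y)"
    and w: "integrable N w"
    and bound: "\<And>y. y \<in> S \<Longrightarrow> AE s in N. norm (f y s - f x s) \<le> w s * norm (y - x)"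
    and der: "AE s in N. ((\<lambda>y. f y s) has_field_derivative f' s) (at x)"
    and meas: "f' \<in> borel_measurable N"
  shows "((\<lambda>y. \<integral>s. f y s \<partial>N) has_field_derivative (\<integral>s. f' s \<partial>N)) (at x)"
proof -
  \<comment> \<open>Since \<open>S\<close> is open, limits at \<open>x\<close> within
    \<open>S\<close> are full limits, so only sequences inside \<open>S\<close>, where the bounds
    hold, need to be considered.\<close>
  have "((\<lambda>y. ((\<integral>s. f y s \<partial>N) - (\<integral>s. f x s \<partial>N)) / (y - x)) \<longlongrightarrow> (\<integral>s. f' s \<partial>N)) (at x within S)"
    unfolding tendsto_at_iff_sequentially
  proof (intro allI impI)
    fix X :: "nat \<Rightarrow> 'b"
    assume X: "\<forall>i. X i \<in> S - {x}" "X \<longlonglongrightarrow> x"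
    have "(\<lambda>i. \<integral>s. (f (X i) s - f x s) / (X i - x) \<partial>N) \<longlonglongrightarrow> (\<integral>s. f' s \<partial>N)"
    proof (rule integral_dominated_convergence[OF meas _ w])
      show "(\<lambda>s. (f (X i) s - f x s) / (X i - x)) \<in> borel_measurable N" for i
        using int[of "X i"] int[of x] X S by auto
      show "AE s in N. (\<lambda>i. (f (X i) s - f x s) / (X i - x)) \<longlonglongrightarrow> f' s"
        using der
      proof eventually_elim
        case (elim s)
        then have "((\<lambda>y. (f y s - f x s) / (y - x)) \<longlongrightarrow> f' s) (at x)"
          by (simp add: has_field_derivative_iff)
        moreover have "filterlim X (at x) sequentially"
          using X by (auto simp: filterlim_at)
        ultimately show ?case
          by (rule filterlim_compose)
      qed
      show "AE s in N. norm ((f (X i) s - f x s) / (X i - x)) \<le> w s" for i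
      proof -
        have "X i \<in> S" "X i \<noteq> x" using X by auto
        from bound[OF this(1)] show ?thesis
          by eventually_elim (use \<open>X i \<noteq> x\<close> in \<open>simp add: norm_divide divide_le_eq\<close>)
      qed
    qed
    also have "(\<lambda>i. \<integral>s. (f (X i) s - f x s) / (X i - x) \<partial>N) =
        (\<lambda>i. ((\<integral>s. f (X i) s \<partial>N) - (\<integral>s. f x s \<partial>N)) / (X i - x))"
      using int[of "X i" for i] int[of x] X S by simp
    finally show "((\<lambda>y. ((\<integral>s. f y s \<partial>N) - (\<integral>s. f x s \<partial>N)) / (y - x)) \<circ> X) \<longlonglongrightarrow> (\<integral>s. f' s \<partial>N)"
      by (simp add: comp_def)
  qed
  then show ?thesis
    using at_within_open[OF S(2,1)] by (simp add: has_field_derivative_iff)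
qed

subsection \<open>From Laplace transforms to characteristic functions\<close>

text \<open>Mean value inequality on a convex half-plane, where the derivative in \<open>z\<close>
  has modulus at most \<open>x * exp (- \<delta> * x)\<close>. Taking \<open>\<delta> = 0\<close>
  bounds 1 - exp (- z x); a positive \<open>\<delta>\<close> yields majorants for difference
  quotients.\<close>

lemma norm_exp_mult_diff_le:
  fixes z y :: complex
  assumes "0 \<le> x" "\<delta> \<le> Re z" "\<delta> \<le> Re y"
  shows "norm (exp (- z * of_real x) - exp (- y * of_real x)) \<le> x * exp (- \<delta> * x) * norm (z - y)"
proof (rule field_differentiable_bound[where S = "{z. \<delta> \<le> Re z}"])
  show "convex {z. \<delta> \<le> Re z}" by (rule convex_halfspace_Re_ge)
  show "((\<lambda>z. exp (- z * of_real x)) has_field_derivative - of_real x * exp (- v * of_real x))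
      (at v within {z. \<delta> \<le> Re z})" for v
    by (auto intro!: derivative_eq_intros)
  show "norm (- of_real x * exp (- v * of_real x)) \<le> x * exp (- \<delta> * x)"
    if "v \<in> {z. \<delta> \<le> Re z}" for v
    using that assms(1) by (auto simp: norm_mult intro!: mult_left_mono mult_right_mono)
qed (use assms in auto)

text \<open>The bound |z| x serves small \<open>x\<close>, the bound 2 serves large
  \<open>x\<close>; together they give a multiple of \<open>min 1 x\<close>, the function that a
  Levy measure integrates.\<close>

lemma norm_one_minus_exp_le:
  fixes z :: complex
  assumes "0 \<le> x" "0 \<le> Re z"
  shows "norm (1 - exp (- z * of_real x)) \<le> (norm z + 2) * min 1 x"
proof -
  have 1: "norm (1 - exp (- z * of_real x)) \<le> norm z * x"
    using norm_exp_mult_diff_le[of x 0 0 z] assms by (simp add: mult.commute)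
  have "norm (exp (- z * of_real x)) \<le> 1"
    using assms by simp
  then have 2: "norm (1 - exp (- z * of_real x)) \<le> 2"
    using norm_triangle_ineq4[of 1 "exp (- z * of_real x)"] unfolding norm_one by linarith
  show ?thesis
  proof (cases "x \<le> 1")
    case True
    then show ?thesis using 1 assms by (simp add: algebra_simps min_def)
  next
    case False
    then show ?thesis using 2 norm_ge_zero[of z] by (simp add: min_def del: norm_ge_zero)
  qed
qed

text \<open>The factor \<open>x\<close> alone may fail to be integrable at infinity against a Levy
  measure; the exponential damping brings it back under a multiple of
  \<open>min 1 x\<close>.\<close>

lemma mult_exp_minus_le:
  fixes x :: real
  assumes "0 \<le> x" "0 < \<delta>"
  shows "x * exp (- \<delta> * x) \<le> max 1 (1 / \<delta>) * min 1 x"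
proof (cases "x \<le> 1")
  case True
  have "x * exp (- \<delta> * x) \<le> x * 1"
    using assms by (intro mult_left_mono) auto
  also have "\<dots> \<le> max 1 (1 / \<delta>) * x"
    using assms by (simp add: mult_le_cancel_right1)
  finally show ?thesis using True by simp
next
  case False
  have "\<delta> * x \<le> exp (\<delta> * x)"
    using exp_ge_add_one_self[of "\<delta> * x"] by linarith
  then have "x * exp (- \<delta> * x) \<le> 1 / \<delta>"
    using assms by (simp add: exp_minus field_simps)
  then show ?thesis using False by simp
qed

text \<open>All integrands are dominated by multiples of \<open>min 1 (X s)\<close>, so
  \<open>N\<close> may have infinite mass; this is why 1 - exp is integrated instead of exp. The
  same facts then apply to a nonnegative random variable and to a Levy measure.\<close>

lemma
  fixes X :: "'a \<Rightarrow> real"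
  assumes X: "X \<in> borel_measurable N" "AE s in N. 0 \<le> X s" "integrable N (\<lambda>s. min 1 (X s))"
  shows integrable_one_minus_exp:
      "\<And>z. 0 \<le> Re z \<Longrightarrow> integrable N (\<lambda>s. 1 - exp (- z * of_real (X s)))"
    and holomorphic_integral_one_minus_exp:
      "(\<lambda>z. \<integral>s. 1 - exp (- z * of_real (X s)) \<partial>N) holomorphic_on {z. 0 < Re z}"
    and tendsto_integral_one_minus_exp:
      "\<And>z. 0 \<le> Re z \<Longrightarrow> (\<lambda>n. \<integral>s. 1 - exp (- (z + of_real (1 / Suc n)) * of_real (X s)) \<partial>N) \<longlonglongrightarrow>
         (\<integral>s. 1 - exp (- z * of_real (X s)) \<partial>N)"
proof -
  note [measurable] = X(1)
  have meas: "(\<lambda>s. 1 - exp (- z * of_real (X s))) \<in> borel_measurable N" for z :: complex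
    by measurable
  show int: "integrable N (\<lambda>s. 1 - exp (- z * of_real (X s)))" if z: "0 \<le> Re z" for z
  proof (rule Bochner_Integration.integrable_bound)
    show "integrable N (\<lambda>s. (norm z + 2) * min 1 (X s))"
      using X(3) by simp
    show "AE s in N. norm (1 - exp (- z * of_real (X s))) \<le> norm ((norm z + 2) * min 1 (X s))"
      using X(2) by eventually_elim (rule order_trans[OF norm_one_minus_exp_le], use z in auto)
  qed (rule meas)
  show "(\<lambda>z. \<integral>s. 1 - exp (- z * of_real (X s)) \<partial>N) holomorphic_on {z. 0 < Re z}"
  proof (subst holomorphic_on_open, rule open_halfspace_Re_gt, intro ballI)
    fix z :: complex assume "z \<in> {z. 0 < Re z}"
    \<comment> \<open>Half of \<open>Re z\<close> keeps a neighbourhood of \<open>z\<close> at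
      positive distance from the imaginary axis, where the constant
      \<open>max 1 (1 / \<delta>)\<close> would blow up.\<close>
    define \<delta> where "\<delta> = Re z / 2"
    have \<delta>: "0 < \<delta>" "\<delta> < Re z" using \<open>z \<in> _\<close> by (auto simp: \<delta>_def)
    have "((\<lambda>z. \<integral>s. 1 - exp (- z * of_real (X s)) \<partial>N) has_field_derivative
        (\<integral>s. of_real (X s) * exp (- z * of_real (X s)) \<partial>N)) (at z)"
    proof (rule has_field_derivative_integral[where S = "{z. \<delta> < Re z}"
          and w = "\<lambda>s. max 1 (1 / \<delta>) * min 1 (X s)"])
      show "open {z. \<delta> < Re z}" by (rule open_halfspace_Re_gt)
      show "integrable N (\<lambda>s. 1 - exp (- y * of_real (X s)))" if "y \<in> {z. \<delta> < Re z}" for y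
        using that \<delta> by (intro int) auto
      show "AE s in N. norm (1 - exp (- y * of_real (X s)) - (1 - exp (- z * of_real (X s))))
          \<le> max 1 (1 / \<delta>) * min 1 (X s) * norm (y - z)" if "y \<in> {z. \<delta> < Re z}" for y
        using X(2)
      proof eventually_elim
        case (elim s)
        have "norm (1 - exp (- y * of_real (X s)) - (1 - exp (- z * of_real (X s))))
            = norm (exp (- z * of_real (X s)) - exp (- y * of_real (X s)))"
          by (simp add: algebra_simps)
        also have "\<dots> \<le> X s * exp (- \<delta> * X s) * norm (z - y)"
          using elim that \<delta> by (intro norm_exp_mult_diff_le) auto
        also have "\<dots> \<le> max 1 (1 / \<delta>) * min 1 (X s) * norm (z - y)"
          using elim \<delta> by (intro mult_right_mono mult_exp_minus_le) auto
        finally show ?case by (simp add: norm_minus_commute)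
      qed
      show "AE s in N. ((\<lambda>y. 1 - exp (- y * of_real (X s))) has_field_derivative
          of_real (X s) * exp (- z * of_real (X s))) (at z)"
        by (intro AE_I2) (auto intro!: derivative_eq_intros)
      show "(\<lambda>s. of_real (X s) * exp (- z * of_real (X s))) \<in> borel_measurable N"
        by measurable
    qed (use X(3) \<delta> in auto)
    then show "\<exists>f'. ((\<lambda>z. \<integral>s. 1 - exp (- z * of_real (X s)) \<partial>N) has_field_derivative f') (at z)"
      by blast
  qed
  show "(\<lambda>n. \<integral>s. 1 - exp (- (z + of_real (1 / Suc n)) * of_real (X s)) \<partial>N) \<longlonglongrightarrow>
         (\<integral>s. 1 - exp (- z * of_real (X s)) \<partial>N)" if z: "0 \<le> Re z" for z
  \<comment> \<open>The shift by \<open>1 / Suc n\<close> raises the norm by at most 1, so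
    \<open>norm z + 2\<close> becomes \<open>norm z + 3\<close> uniformly in
    \<open>n\<close>.\<close>
  proof (rule integral_dominated_convergence[where w = "\<lambda>s. (norm z + 3) * min 1 (X s)"])
    have "(\<lambda>n. 1 / real (Suc n)) \<longlonglongrightarrow> 0"
      using LIMSEQ_inverse_real_of_nat by (simp add: inverse_eq_divide)
    then have "(\<lambda>n. 1 - exp (- (z + of_real (1 / Suc n)) * of_real (X s))) \<longlonglongrightarrow>
        1 - exp (- (z + of_real 0) * of_real (X s))" for s
      by (intro tendsto_intros)
    then show "AE s in N. (\<lambda>n. 1 - exp (- (z + of_real (1 / Suc n)) * of_real (X s))) \<longlonglongrightarrow>
        1 - exp (- z * of_real (X s))"
      by simp
    show "AE s in N. norm (1 - exp (- (z + of_real (1 / Suc n)) * of_real (X s))) \<le>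
        (norm z + 3) * min 1 (X s)" for n
      using X(2)
    proof eventually_elim
      case (elim s)
      have "norm (z + of_real (1 / Suc n)) \<le> norm z + 1"
        by (rule order_trans[OF norm_triangle_ineq], subst norm_of_real) simp
      then have "(norm (z + of_real (1 / Suc n)) + 2) * min 1 (X s) \<le> (norm z + 3) * min 1 (X s)"
        using elim by (intro mult_right_mono) auto
      moreover have "0 \<le> Re (z + of_real (1 / Suc n))" using z by simp
      ultimately show ?case
        using norm_one_minus_exp_le[OF elim, of "z + of_real (1 / Suc n)"] by linarith
    qed
    show "integrable N (\<lambda>s. (norm z + 3) * min 1 (X s))" using X(3) by simp
  qed (rule meas)+
qed

text \<open>The identity theorem carries the equality from the positive reals to the open right
  half-plane, and a horizontal limit carries it on to the imaginary axis.\<close>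

lemma char_eq_of_laplace_eq:
  fixes X :: "'a \<Rightarrow> real" and h :: "'b \<Rightarrow> real"
  assumes "prob_space M"
    and X: "X \<in> borel_measurable M" "AE s in M. 0 \<le> X s"
    and h: "h \<in> borel_measurable N" "AE s in N. 0 \<le> h s" "integrable N (\<lambda>s. min 1 (h s))"
    and laplace: "\<And>l. 0 < l \<Longrightarrow> (\<integral>s. exp (- l * X s) \<partial>M) = exp (- t * (\<integral>s. 1 - exp (- l * h s) \<partial>N))"
  shows "char (distr M borel X) u = exp (- of_real t * (\<integral>s. 1 - iexp (u * h s) \<partial>N))"
proof -
  interpret prob_space M by fact
  have X': "integrable M (\<lambda>s. min 1 (X s))"
    by (rule integrable_const_bound[where B = 1]) (use X in auto)
  \<comment> \<open>Since \<open>M\<close> has mass 1, \<open>1 - F z\<close> is the expectation of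
    exp (- z X); in this form both transforms are integrals of the same kind.\<close>
  define F where "F z = (\<integral>s. 1 - exp (- z * of_real (X s)) \<partial>M)" for z :: complex
  define G where "G z = (\<integral>s. 1 - exp (- z * of_real (h s)) \<partial>N)" for z :: complex
  have hol: "(\<lambda>z. (1 - F z) - exp (- of_real t * G z)) holomorphic_on {z. 0 < Re z}"
    unfolding F_def G_def
    by (intro holomorphic_intros holomorphic_integral_one_minus_exp X X' h)
  have real: "(1 - F z) - exp (- of_real t * G z) = 0" if "z \<in> of_real ` {0<..}" for z
  proof -
    obtain l where l: "0 < l" "z = of_real l" using \<open>z \<in> _\<close> by auto
    have "F z = (\<integral>s. of_real (1 - exp (- l * X s)) \<partial>M)"
      unfolding F_def l by (intro Bochner_Integration.integral_cong) (auto simp flip: exp_of_real)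
    also have "\<dots> = of_real (\<integral>s. 1 - exp (- l * X s) \<partial>M)"
      by (rule integral_complex_of_real)
    also have "(\<integral>s. 1 - exp (- l * X s) \<partial>M) = 1 - (\<integral>s. exp (- l * X s) \<partial>M)"
    proof -
      have "integrable M (\<lambda>s. exp (- l * X s))"
      proof (rule integrable_const_bound[where B = 1])
        show "AE s in M. norm (exp (- l * X s)) \<le> 1"
          using X(2) by eventually_elim (use l in auto)
      qed (use X in measurable)
      then show ?thesis by (simp add: prob_space)
    qed
    finally have F: "F z = of_real (1 - (\<integral>s. exp (- l * X s) \<partial>M))" .
    have "G z = (\<integral>s. of_real (1 - exp (- l * h s)) \<partial>N)"
      unfolding G_def l by (intro Bochner_Integration.integral_cong) (auto simp flip: exp_of_real)
    also have "\<dots> = of_real (\<integral>s. 1 - exp (- l * h s) \<partial>N)"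
      by (rule integral_complex_of_real)
    finally have G: "G z = of_real (\<integral>s. 1 - exp (- l * h s) \<partial>N)" .
    show ?thesis
      unfolding F G laplace[OF l(1)] by (simp flip: exp_of_real)
  qed
  \<comment> \<open>The zeros on the positive reals accumulate at 1, an interior point of the
    half-plane, so the holomorphic difference vanishes throughout.\<close>
  have half: "(1 - F z) - exp (- of_real t * G z) = 0" if "0 < Re z" for z
  proof (rule analytic_continuation[OF hol, where U = "of_real ` {0<..}" and \<xi> = 1])
    show "connected {z. 0 < Re z}" by (intro convex_connected convex_halfspace_Re_gt)
    show "(1 :: complex) islimpt of_real ` {0<..}"
      unfolding islimpt_approachable
    proof (intro allI impI)
      fix e :: real assume "0 < e"
      then show "\<exists>y\<in>complex_of_real ` {0<..}. y \<noteq> 1 \<and> dist y 1 < e"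
        by (intro bexI[of _ "of_real (1 + e / 2)"] imageI) (auto simp: dist_norm)
    qed
  qed (use that real in \<open>auto simp: open_halfspace_Re_gt\<close>)
  \<comment> \<open>At this boundary point exp (- z x) is \<open>iexp (u * x)\<close>; the points
    \<open>z + of_real (1 / Suc n)\<close> lie in the open half-plane and tend to it.\<close>
  define z where "z = - \<i> * of_real u"
  have z: "0 \<le> Re z" by (simp add: z_def)
  have "(\<lambda>n. (1 - F (z + of_real (1 / Suc n))) - exp (- of_real t * G (z + of_real (1 / Suc n))))
      \<longlonglongrightarrow> (1 - F z) - exp (- of_real t * G z)"
    unfolding F_def G_def
    by (intro tendsto_intros tendsto_integral_one_minus_exp X X' h z)
  moreover have "(1 - F (z + of_real (1 / Suc n))) - exp (- of_real t * G (z + of_real (1 / Suc n))) = 0"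
    for n by (rule half) (use z in \<open>simp add: add_nonneg_pos\<close>)
  ultimately have "(1 - F z) - exp (- of_real t * G z) = 0"
    by (simp only: LIMSEQ_const_iff)
  moreover have "1 - F z = char (distr M borel X) u"
  proof -
    have "integrable M (\<lambda>s. iexp (u * X s))"
      by (rule integrable_iexp) (use X in auto)
    then show ?thesis
      using X by (simp add: F_def z_def char_def integral_distr prob_space mult.assoc)
  qed
  moreover have "G z = (\<integral>s. 1 - iexp (u * h s) \<partial>N)"
    by (simp add: G_def z_def mult.assoc)
  ultimately show ?thesis by simp
qed

subsection \<open>Fourier inversion\<close>

text \<open>For nonzero \<open>t\<close> the quotient is the integral of
  \<open>iexp (- (t * s))\<close> over \<open>s\<close> from \<open>a\<close> to \<open>b\<close>,
  hence bounded by the length of the interval. At \<open>t = 0\<close> it is 0 by the convention on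
  division.\<close>

lemma norm_inversion_kernel_le:
  fixes a b t :: real
  shows "norm ((iexp (-(t * a)) - iexp (-(t * b))) / (\<i> * t)) \<le> \<bar>b - a\<bar>"
proof -
  have *: "norm ((iexp (-(t * a)) - iexp (-(t * b))) / (\<i> * t)) \<le> b - a" if "a \<le> b" for a b
  proof (cases "t = 0")
    case False
    then show ?thesis
      using Levy_Inversion_aux2[of "- b" "- a" t] that by simp
  qed (use that in simp)
  have "norm ((iexp (-(t * a)) - iexp (-(t * b))) / (\<i> * t)) =
      norm ((iexp (-(t * b)) - iexp (-(t * a))) / (\<i> * t))"
    by (simp add: norm_divide norm_minus_commute)
  then show ?thesis
    using *[of a b] *[of b a] by (cases "a \<le> b") auto
qed

context real_distribution
begin

text \<open>Levy inversion expresses interval probabilities through an integral that now converges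
  absolutely. This excludes atoms and makes the distribution function differentiable with derivative
  \<open>f\<close>; the fundamental theorem of calculus then identifies \<open>f\<close> as the
  density.\<close>

lemma density_of_integrable_char:
  assumes int: "integrable lborel (char M)"
  defines "f \<equiv> \<lambda>x. (\<integral>t. Re (iexp (- (t * x)) * char M t) \<partial>lborel) / (2 * pi)"
  shows "\<And>x. 0 \<le> f x" "continuous_on UNIV f" "bounded (range f)" "M = density lborel f"
proof -
  \<comment> \<open>Real parts of products stay unexpanded, because they are estimated by the norms
    of the products.\<close>
  note times_complex.sel [simp del]
  define K where "K a b t = (iexp (-(t * a)) - iexp (-(t * b))) / (\<i> * t)" for a b t :: real
  define C where "C = (\<integral>t. norm (char M t) \<partial>lborel)"
  have [measurable]: "K a b \<in> borel_measurable borel" for a b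
    unfolding K_def by measurable
  have K_le: "norm (K a b t * char M t) \<le> \<bar>b - a\<bar> * norm (char M t)" for a b t
    unfolding norm_mult K_def by (intro mult_right_mono norm_inversion_kernel_le) simp
  have K_int: "integrable lborel (\<lambda>t. K a b t * char M t)" for a b
  proof (rule Bochner_Integration.integrable_bound)
    show "integrable lborel (\<lambda>t. \<bar>b - a\<bar> * norm (char M t))" using int by simp
    show "AE t in lborel. norm (K a b t * char M t) \<le> norm (\<bar>b - a\<bar> * norm (char M t))"
      using K_le[of a b] by (simp add: abs_mult)
  qed measurable
  have K_int_le: "(\<integral>t. Re (K a b t * char M t) \<partial>lborel) \<le> \<bar>b - a\<bar> * C" for a b
  proof -
    have "(\<integral>t. Re (K a b t * char M t) \<partial>lborel) \<le> (\<integral>t. \<bar>b - a\<bar> * norm (char M t) \<partial>lborel)"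
      using K_int int
      by (intro integral_mono order_trans[OF complex_Re_le_cmod K_le]) auto
    then show ?thesis by (simp add: C_def)
  qed
  \<comment> \<open>Inversion is a limit of integrals over symmetric intervals, for endpoints that
    are not atoms. Integrability of the characteristic function turns the limit into one integral
    over the line.\<close>
  have inv: "measure M {a<..b} = (\<integral>t. Re (K a b t * char M t) \<partial>lborel) / (2 * pi)"
    if "a \<le> b" "measure M {a} = 0" "measure M {b} = 0" for a b
  proof -
    have eq: "(CLBINT t=-real n..real n. K a b t * char M t) =
        (\<integral>t. indicator {- real n<..<real n} t *\<^sub>R (K a b t * char M t) \<partial>lborel)" for n :: nat
      by (simp only: interval_lebesgue_integral_def set_lebesgue_integral_def uminus_ereal.simps
          einterval_eq ereal_less_eq) simp
    have "(\<lambda>n. CLBINT t=-real n..real n. K a b t * char M t) \<longlonglongrightarrow> (\<integral>t. K a b t * char M t \<partial>lborel)"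
      unfolding eq
    proof (rule integral_dominated_convergence[where f = "\<lambda>t. K a b t * char M t" and w = "\<lambda>t. norm (K a b t * char M t)"])
      show "AE t in lborel. (\<lambda>n. indicator {- real n<..<real n} t *\<^sub>R (K a b t * char M t)) \<longlonglongrightarrow>
          K a b t * char M t"
      proof (intro AE_I2 tendsto_eventually)
        fix t :: real
        obtain m :: nat where "\<bar>t\<bar> < m" using reals_Archimedean2[of "\<bar>t\<bar>"] by blast
        then show "\<forall>\<^sub>F n in sequentially. indicator {- real n<..<real n} t *\<^sub>R (K a b t * char M t) =
            K a b t * char M t"
          by (intro eventually_sequentiallyI[of m]) (auto simp: indicator_def abs_less_iff)
      qed
      show "AE t in lborel. norm (indicator {- real n<..<real n} t *\<^sub>R (K a b t * char M t))
          \<le> norm (K a b t * char M t)" for n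
        by (auto simp: indicator_def abs_less_iff)
    qed (use K_int in auto)
    then have "(\<lambda>n. 1 / (2 * pi) * (CLBINT t=-real n..real n. K a b t * char M t)) \<longlonglongrightarrow>
        1 / (2 * pi) * (\<integral>t. K a b t * char M t \<partial>lborel)"
      by (intro tendsto_intros)
    moreover have "(\<lambda>n. 1 / (2 * pi) * (CLBINT t=-real n..real n. K a b t * char M t)) \<longlonglongrightarrow>
        measure M {a<..b}"
      unfolding K_def using Levy_Inversion[OF that] by simp
    ultimately have "of_real (measure M {a<..b}) = 1 / (2 * pi) * (\<integral>t. K a b t * char M t \<partial>lborel)"
      by (rule LIMSEQ_unique[symmetric])
    then have "of_real (measure M {a<..b}) =
        of_real (1 / (2 * pi)) * (\<integral>t. K a b t * char M t \<partial>lborel)"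
      by simp
    from arg_cong[where f = Re, OF this]
    have "measure M {a<..b} = 1 / (2 * pi) * Re (\<integral>t. K a b t * char M t \<partial>lborel)"
      by (simp only: times_complex.sel Re_complex_of_real Im_complex_of_real mult_zero_left diff_zero)
    then show ?thesis
      using K_int by (simp add: integral_Re)
  qed
  have atomless: "measure M {x} = 0" for x
  proof (rule ccontr)
    assume "measure M {x} \<noteq> 0"
    then have pos: "0 < measure M {x}" by (simp add: zero_less_measure_iff)
    have "0 \<le> C" by (simp add: C_def)
    \<comment> \<open>An interval of length below \<open>2 * e\<close> whose endpoints are not atoms
      has mass at most \<open>2 * e * C / (2 * pi)\<close>, that is
      \<open>measure M {x} * (C / (C + 1))\<close>, which is less than the mass of an atom at
      \<open>x\<close>. Adding 1 keeps the denominator positive.\<close>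
    define e where "e = measure M {x} * pi / (C + 1)"
    have e: "0 < e" using pos \<open>0 \<le> C\<close> by (simp add: e_def)
    \<comment> \<open>Only countably many points are atoms, so every nonempty open interval contains
      a point of mass zero.\<close>
    obtain a where a: "a \<in> {x - e<..<x}" "measure M {a} = 0"
      using open_minus_countable[OF countable_support, of "{x - e<..<x}"] e by auto
    obtain b where b: "b \<in> {x<..<x + e}" "measure M {b} = 0"
      using open_minus_countable[OF countable_support, of "{x<..<x + e}"] e by auto
    have "measure M {x} \<le> measure M {a<..b}"
      using a b by (intro finite_measure_mono) auto
    also have "\<dots> \<le> \<bar>b - a\<bar> * C / (2 * pi)"
      using a b K_int_le[of a b] by (subst inv) (auto intro!: divide_right_mono)
    also have "\<dots> \<le> (2 * e) * C / (2 * pi)"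
      using a b \<open>0 \<le> C\<close> by (intro divide_right_mono mult_right_mono) auto
    also have "\<dots> = measure M {x} * (C / (C + 1))"
      by (simp add: e_def)
    also have "\<dots> < measure M {x} * 1"
      using pos \<open>0 \<le> C\<close> by (intro mult_strict_left_mono) auto
    finally show False by simp
  qed
  have K_swap: "K b a t = - K a b t" for a b t
    by (simp only: K_def minus_divide_left minus_diff_eq)
  \<comment> \<open>For negative \<open>y\<close> inversion is applied from \<open>y\<close> to 0,
    and the antisymmetry of \<open>K\<close> supplies the sign.\<close>
  have cdf_eq: "cdf M y = cdf M 0 + (\<integral>t. Re (K 0 y t * char M t) \<partial>lborel) / (2 * pi)" for y
  proof -
    consider "y = 0" | "0 < y" | "y < 0" by linarith
    then show ?thesis
    proof cases
      case 1
      then show ?thesis by (simp add: K_def)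
    next
      case 2
      then show ?thesis
        using inv[of 0 y] cdf_diff_eq[of 0 y] atomless by simp
    next
      case 3
      then show ?thesis
        using inv[of y 0] cdf_diff_eq[of y 0] atomless by (simp add: K_swap[of y 0])
    qed
  qed
  have deriv: "(cdf M has_real_derivative f x) (at x)" for x
  proof -
    have "((\<lambda>y. \<integral>t. Re (K 0 y t * char M t) \<partial>lborel) has_real_derivative
        (\<integral>t. Re (iexp (- (t * x)) * char M t) \<partial>lborel)) (at x)"
    proof (rule has_field_derivative_integral[where S = UNIV and w = "\<lambda>t. norm (char M t)"])
      show "AE t in lborel. norm (Re (K 0 y t * char M t) - Re (K 0 x t * char M t))
          \<le> norm (char M t) * norm (y - x)" for y
      proof (rule AE_I2)
        fix t :: real
        have "Re (K 0 y t * char M t) - Re (K 0 x t * char M t) = Re (K x y t * char M t)"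
          by (simp only: flip: minus_complex.sel left_diff_distrib) (simp add: K_def flip: diff_divide_distrib)
        also have "norm \<dots> \<le> norm (K x y t * char M t)"
          unfolding real_norm_def by (rule abs_Re_le_cmod)
        also have "\<dots> \<le> \<bar>y - x\<bar> * norm (char M t)"
          by (rule K_le)
        finally show "norm (Re (K 0 y t * char M t) - Re (K 0 x t * char M t))
          \<le> norm (char M t) * norm (y - x)" by (simp only: real_norm_def mult.commute)
      qed
      show "AE t in lborel. ((\<lambda>y. Re (K 0 y t * char M t)) has_real_derivative
          Re (iexp (- (t * x)) * char M t)) (at x)"
        \<comment> \<open>At \<open>t = 0\<close> the kernel is 0 for every \<open>y\<close>, while
          the claimed derivative is \<open>char M 0\<close>, which is 1; this null set is therefore
          left out.\<close>
        using AE_lborel_singleton[of 0]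
      proof eventually_elim
        case (elim t)
        have "((\<lambda>y. (1 - exp (- \<i> * of_real t * y)) / (\<i> * of_real t) * char M t) has_field_derivative
            exp (- \<i> * of_real t * of_real x) * char M t) (at (of_real x))"
          using elim by (auto intro!: derivative_eq_intros)
        from has_field_derivative_Re[OF has_vector_derivative_real_field[OF this]]
        show ?case by (simp add: K_def mult.assoc)
      qed
    qed (use K_int int in auto)
    then have "((\<lambda>y. cdf M 0 + (\<integral>t. Re (K 0 y t * char M t) \<partial>lborel) / (2 * pi)) has_real_derivative f x) (at x)"
      unfolding f_def by (auto intro!: derivative_eq_intros)
    then show ?thesis by (simp only: cdf_eq[abs_def, symmetric])
  qed
  show f_nonneg: "0 \<le> f x" for x
    using mono_on_imp_deriv_nonneg[OF _ deriv, of UNIV x] cdf_nondecreasing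
    by (auto simp: mono_on_def)
  have iexp_le: "norm (Re (iexp (- (t * x)) * char M t)) \<le> norm (char M t)" for t x
    using abs_Re_le_cmod[of "iexp (- (t * x)) * char M t"]
    by (simp only: norm_mult norm_exp_i_times real_norm_def mult_1_left)
  have "isCont f x" for x
    unfolding f_def
  proof (intro continuous_intros, unfold continuous_at_sequentially comp_def, intro allI impI)
    fix X assume "X \<longlonglongrightarrow> x"
    then show "(\<lambda>n. \<integral>t. Re (iexp (- (t * X n)) * char M t) \<partial>lborel) \<longlonglongrightarrow>
        (\<integral>t. Re (iexp (- (t * x)) * char M t) \<partial>lborel)"
      using int iexp_le
      by (intro integral_dominated_convergence[where w = "\<lambda>t. norm (char M t)"])
         (auto intro!: tendsto_intros)
  qed simp
  then show cont: "continuous_on UNIV f"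
    by (simp add: continuous_at_imp_continuous_on)
  have "norm (f x) \<le> C / (2 * pi)" for x
  proof -
    have "norm (\<integral>t. Re (iexp (- (t * x)) * char M t) \<partial>lborel) \<le> C"
      unfolding C_def
      by (rule order_trans[OF integral_norm_bound integral_mono']) (use int iexp_le in auto)
    then show ?thesis by (simp add: f_def divide_right_mono)
  qed
  then show "bounded (range f)" by (auto simp: bounded_iff)
  have [measurable]: "f \<in> borel_measurable borel"
    using cont by (rule borel_measurable_continuous_onI)
  show "M = density lborel f"
  proof (rule measure_eqI_lessThan)
    fix x
    have "emeasure (density lborel f) {x<..} = (\<integral>\<^sup>+t. ennreal (f t) * indicator {x<..} t \<partial>lborel)"
      by (simp add: emeasure_density)
    \<comment> \<open>The endpoint is a null set; the closed half-line is the form in which the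
      fundamental theorem of calculus is applied.\<close>
    also have "\<dots> = (\<integral>\<^sup>+t. ennreal (f t) * indicator {x..} t \<partial>lborel)"
      using AE_lborel_singleton[of x]
      by (intro nn_integral_cong_AE) (auto elim!: eventually_mono simp: indicator_def)
    also have "\<dots> = 1 - cdf M x"
      using deriv f_nonneg cdf_lim_at_top_prob by (intro nn_integral_FTC_atLeast) auto
    also have "1 - cdf M x = measure M {x<..}"
      using prob_compl[of "{..x}"] by (simp add: cdf_def Compl_eq_Diff_UNIV[symmetric])
    finally show "emeasure M {x<..} = emeasure (density lborel f) {x<..}"
      by (simp add: emeasure_eq_measure)
  qed (auto simp: less_top[symmetric])
qed

end

subsection \<open>Decay of the characteristic function\<close>

lemma integrable_powr_at_top:
  fixes a K :: real
  assumes "1 < a" "0 < K"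
  shows "integrable lborel (\<lambda>u. u powr - a * indicator {K..} u)"
proof (rule integrableI_nonneg)
  have "(\<integral>\<^sup>+u. ennreal (u powr - a * indicator {K..} u) \<partial>lborel) =
      (\<integral>\<^sup>+u. ennreal (u powr - a) * indicator {K..} u \<partial>lborel)"
    by (intro nn_integral_cong) (auto simp: indicator_def)
  also have "\<dots> = 0 - K powr (1 - a) / (1 - a)"
  proof (rule nn_integral_FTC_atLeast[where F = "\<lambda>u. u powr (1 - a) / (1 - a)"])
    show "((\<lambda>u. u powr (1 - a) / (1 - a)) has_real_derivative u powr - a) (at u)" if "K \<le> u" for u
      using that assms by (auto intro!: derivative_eq_intros)
    have "((\<lambda>u. u powr (1 - a)) \<longlongrightarrow> 0) at_top"
      using assms by (intro tendsto_neg_powr filterlim_ident) auto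
    then show "((\<lambda>u. u powr (1 - a) / (1 - a)) \<longlongrightarrow> 0) at_top"
      by (rule tendsto_divide_zero)
  qed auto
  finally show "(\<integral>\<^sup>+u. ennreal (u powr - a * indicator {K..} u) \<partial>lborel) < \<infinity>" by simp
qed auto

lemma integrable_of_powr_decay:
  fixes f :: "real \<Rightarrow> 'a :: {banach, second_countable_topology}"
  assumes meas: "f \<in> borel_measurable borel" and "1 < a" "0 < K"
    and bound: "\<And>u. norm (f u) \<le> B"
    and decay: "\<And>u. K \<le> \<bar>u\<bar> \<Longrightarrow> norm (f u) \<le> C * \<bar>u\<bar> powr - a"
  shows "integrable lborel f"
proof (rule Bochner_Integration.integrable_bound)
  let ?p = "\<lambda>u :: real. u powr - a * indicator {K..} u"
  \<comment> \<open>The majorant is the constant \<open>B\<close> on the middle interval plus a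
    power tail on each side, the left one by reflection.\<close>
  let ?w = "\<lambda>u. B * indicator {-K..K} u + C * ?p u + C * ?p (- u)"
  have p: "integrable lborel ?p" using assms by (intro integrable_powr_at_top)
  moreover have "integrable lborel (\<lambda>u. ?p (- u))"
    using lborel_integrable_real_affine[OF p, of "-1" 0] by simp
  ultimately show "integrable lborel ?w"
    by (intro Bochner_Integration.integrable_add integrable_mult_right integrable_real_indicator)
       (auto simp: emeasure_lborel_Icc_eq)
  show "AE u in lborel. norm (f u) \<le> norm (?w u)"
  proof (rule AE_I2)
    fix u :: real
    have "0 \<le> B" using bound[of 0] norm_ge_zero order_trans by blast
    \<comment> \<open>The decay bound at \<open>u = K\<close> forces \<open>C\<close> to be
      nonnegative.\<close>
    have "0 \<le> C * K powr - a"
      using decay[of K] \<open>0 < K\<close> norm_ge_zero[of "f K"] by (simp del: norm_ge_zero)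
    then have "0 \<le> C" using \<open>0 < K\<close> by (simp add: zero_le_mult_iff)
    have "norm (f u) \<le> ?w u"
    proof (cases "\<bar>u\<bar> \<le> K")
      case True
      then have "norm (f u) \<le> B * indicator {-K..K} u"
        using bound by (auto simp: indicator_def abs_le_iff)
      also have "\<dots> \<le> ?w u" using \<open>0 \<le> C\<close> by auto
      finally show ?thesis .
    next
      case False
      then have "norm (f u) \<le> C * \<bar>u\<bar> powr - a" by (intro decay) simp
      also have "\<dots> \<le> ?w u" using False \<open>0 \<le> B\<close> \<open>0 \<le> C\<close> by (auto simp: indicator_def abs_if)
      finally show ?thesis .
    qed
    then show "norm (f u) \<le> norm (?w u)" by simp
  qed
qed (use meas in simp)

text \<open>The function \<open>g\<close> below falls short of \<open>(1 - cos (u s)) / s\<close> by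
  \<open>(1 - sin (u s)) / (u s\<^sup>2)\<close>; subtracting this term makes the antiderivative \<open>G\<close> elementary
  and costs only a bounded amount.\<close>

lemma ln_le_integral_one_minus_cos:
  fixes \<nu> :: "real \<Rightarrow> real"
  assumes \<nu>: "integrable lborel (\<lambda>s. \<nu> s * (1 - cos (u * s)))" "\<And>s. 0 \<le> \<nu> s"
    and c: "\<And>s. 0 < s \<Longrightarrow> s \<le> \<delta> \<Longrightarrow> c \<le> s * \<nu> s" "0 \<le> c"
    and u: "0 < u" "1 \<le> u * \<delta>"
  shows "c * (ln (u * \<delta>) - 2) \<le> (\<integral>s. \<nu> s * (1 - cos (u * s)) \<partial>lborel)"
proof -
  define G where "G s = ln (u * s) - sin (u * s) / (u * s) + 1 / (u * s)" for s
  define g where "g s = 1 / s - cos (u * s) / s - (1 - sin (u * s)) / (u * s\<^sup>2)" for s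
  have \<delta>: "0 < \<delta>" "1 / u \<le> \<delta>"
    using u by (auto simp: field_simps zero_less_mult_iff dest: order_less_le_trans[OF zero_less_one])
  have pos: "0 < s" if "1 / u \<le> s" for s
    using that u by (meson divide_pos_pos less_le_trans zero_less_one)
  have deriv: "(G has_real_derivative g s) (at s)" if "1 / u \<le> s" for s
    unfolding G_def g_def using pos[OF that] u
    by (auto intro!: derivative_eq_intros simp: field_simps power2_eq_square)
  have cont: "continuous_on {1 / u..\<delta>} g"
    unfolding g_def using pos u by (force intro!: continuous_intros)
  \<comment> \<open>At \<open>\<delta>\<close> the sine term is at most the last term, so
    \<open>G \<delta>\<close> is at least \<open>ln (u * \<delta>)\<close>; at \<open>1 / u\<close>
    the logarithm vanishes and \<open>G\<close> equals 1 - sin 1, at most 2.\<close>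
  have "c * (ln (u * \<delta>) - 2) \<le> c * (G \<delta> - G (1 / u))"
  proof (rule mult_left_mono)
    have "sin (u * \<delta>) / (u * \<delta>) \<le> 1 / (u * \<delta>)"
      using u \<delta> by (intro divide_right_mono) auto
    moreover have "G (1 / u) \<le> 2"
      using u sin_ge_minus_one[of 1] by (simp add: G_def)
    ultimately show "ln (u * \<delta>) - 2 \<le> G \<delta> - G (1 / u)"
      by (simp add: G_def)
  qed fact
  also have "\<dots> = (\<integral>s. c * (indicator {1 / u..\<delta>} s *\<^sub>R g s) \<partial>lborel)"
    using \<delta> deriv
    by (subst integral_mult_right_zero, subst integral_FTC_atLeastAtMost[OF _ _ cont, where F = G])
       (auto intro: has_field_derivative_at_within simp flip: has_real_derivative_iff_has_vector_derivative)
  also have "\<dots> \<le> (\<integral>s. \<nu> s * (1 - cos (u * s)) \<partial>lborel)"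
  proof (rule integral_mono)
    show "integrable lborel (\<lambda>s. c * (indicator {1 / u..\<delta>} s *\<^sub>R g s))"
      using borel_integrable_atLeastAtMost'[OF cont]
      unfolding set_integrable_def by (rule integrable_mult_right)
    \<comment> \<open>On the window the term subtracted in \<open>g\<close> is nonnegative and
      \<open>c / s \<le> \<nu> s\<close>; off the window the left side is 0 and the right side
      nonnegative.\<close>
    show "c * (indicator {1 / u..\<delta>} s *\<^sub>R g s) \<le> \<nu> s * (1 - cos (u * s))" for s
    proof (cases "s \<in> {1 / u..\<delta>}")
      case True
      then have s: "0 < s" "s \<le> \<delta>" using pos by auto
      have "g s \<le> (1 - cos (u * s)) / s"
        using s u divide_right_mono[OF sin_le_one, of "u * s\<^sup>2" "u * s"]
        by (simp add: g_def diff_divide_distrib)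
      then have "c * g s \<le> c * ((1 - cos (u * s)) / s)"
        using c(2) by (rule mult_left_mono)
      also have "\<dots> = c / s * (1 - cos (u * s))" by simp
      also have "\<dots> \<le> \<nu> s * (1 - cos (u * s))"
        using c(1)[OF s] s by (intro mult_right_mono) (auto simp: field_simps)
      finally show ?thesis using True by simp
    qed (use \<nu>(2) in simp)
  qed (fact \<nu>(1))
  finally show ?thesis .
qed

section \<open>The Levy measure and the decay it forces\<close>

locale levy_measure_density =
  fixes \<nu> :: "real \<Rightarrow> real"
  assumes levy_density: "levy_density \<nu>"
begin

text \<open>Extension by zero: nothing is known about \<open>\<nu>\<close> off the positive
  half-line, while a density with respect to \<open>lborel\<close> should be measurable and
  nonnegative on the whole line.\<close>

definition \<nu>0 :: "real \<Rightarrow> real" where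
  "\<nu>0 s = indicator {0<..} s * \<nu> s"

definition levy_measure :: "real measure" where
  "levy_measure = density lborel \<nu>0"

lemma \<nu>0_nonneg: "0 \<le> \<nu>0 s"
  using levy_density by (auto simp: \<nu>0_def levy_density_def indicator_def)

text \<open>Measurability is inherited from the integrable function \<open>min 1 s * \<nu> s\<close>
  on dividing by \<open>min 1 s\<close>, which is positive on the half-line; at \<open>s = 0\<close>
  the quotient 0 / 0 is 0.\<close>

lemma \<nu>0_measurable [measurable]: "\<nu>0 \<in> borel_measurable borel"
proof -
  have "set_borel_measurable lborel {0<..} (\<lambda>s. min 1 s * \<nu> s)"
    using levy_density
    by (auto simp: levy_density_def set_integrable_def set_borel_measurable_def)
  then have [measurable]: "(\<lambda>s. indicator {0<..} s *\<^sub>R (min 1 s * \<nu> s)) \<in> borel_measurable borel"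
    by (simp add: set_borel_measurable_def)
  have "\<nu>0 = (\<lambda>s. (indicator {0<..} s *\<^sub>R (min 1 s * \<nu> s)) / min 1 s)"
    by (auto simp: \<nu>0_def fun_eq_iff indicator_def)
  also have "\<dots> \<in> borel_measurable borel" by measurable
  finally show ?thesis .
qed

lemma integral_levy_measure:
  fixes f :: "real \<Rightarrow> 'b :: {banach, second_countable_topology}"
  assumes "f \<in> borel_measurable borel"
  shows "(\<integral>s. f s \<partial>levy_measure) = (\<integral>s. \<nu>0 s *\<^sub>R f s \<partial>lborel)"
  unfolding levy_measure_def using assms \<nu>0_nonneg by (intro integral_density) auto

lemma integrable_levy_measure:
  fixes f :: "real \<Rightarrow> 'b :: {banach, second_countable_topology}"
  assumes "f \<in> borel_measurable borel"
  shows "integrable levy_measure f \<longleftrightarrow> integrable lborel (\<lambda>s. \<nu>0 s *\<^sub>R f s)"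
  unfolding levy_measure_def using assms \<nu>0_nonneg by (intro integrable_density) auto

lemma levy_measure_nonneg: "AE s in levy_measure. 0 \<le> s"
  unfolding levy_measure_def by (subst AE_density, measurable) (auto simp: \<nu>0_def indicator_def)

lemma integrable_min_levy_measure: "integrable levy_measure (\<lambda>s. min 1 s)"
  using levy_density
  by (subst integrable_levy_measure) (auto simp: levy_density_def set_integrable_def \<nu>0_def mult_ac)

lemma laplace_exponent_eq: "laplace_exponent \<nu> l = (\<integral>s. 1 - exp (- l * s) \<partial>levy_measure)"
  by (subst integral_levy_measure)
     (auto simp: laplace_exponent_def set_lebesgue_integral_def \<nu>0_def mult_ac)

text \<open>The modulus of the exponential depends only on the real part of its exponent, an
  integral of 1 - cos. Exponentiating the logarithmic lower bound for that integral gives a power of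
  |u|.\<close>

lemma norm_char_le:
  assumes "prob_space M" "X \<in> borel_measurable M" "AE s in M. 0 \<le> X s" "0 \<le> t"
    and "\<And>l. 0 < l \<Longrightarrow> (\<integral>s. exp (- l * X s) \<partial>M) = exp (- t * laplace_exponent \<nu> l)"
    and c: "\<And>s. 0 < s \<Longrightarrow> s \<le> \<delta> \<Longrightarrow> c \<le> s * \<nu> s" "0 \<le> c"
    and \<delta>: "0 < \<delta>" "1 / \<delta> \<le> \<bar>u\<bar>"
  shows "norm (char (distr M borel X) u) \<le> exp (2 * t * c) * \<delta> powr - (t * c) * \<bar>u\<bar> powr - (t * c)"
proof -
  have char: "char (distr M borel X) u = exp (- of_real t * (\<integral>s. 1 - iexp (u * s) \<partial>levy_measure))"
    using assms levy_measure_nonneg integrable_min_levy_measure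
    by (intro char_eq_of_laplace_eq) (auto simp: laplace_exponent_eq levy_measure_def)
  have int: "integrable levy_measure (\<lambda>s. 1 - iexp (u * s))"
    using integrable_one_minus_exp[of "\<lambda>s. s" levy_measure "- \<i> * of_real u"]
      levy_measure_nonneg integrable_min_levy_measure
    by (simp add: mult.assoc levy_measure_def)
  have "Re (\<integral>s. 1 - iexp (u * s) \<partial>levy_measure) = (\<integral>s. Re (1 - iexp (u * s)) \<partial>levy_measure)"
    using int by (rule integral_Re[symmetric])
  \<comment> \<open>Cosine is even, so \<open>u\<close> may be replaced by its absolute value; the
    logarithmic bound asks for a positive frequency.\<close>
  also have "\<dots> = (\<integral>s. 1 - cos (\<bar>u\<bar> * s) \<partial>levy_measure)"
    by (intro Bochner_Integration.integral_cong) (auto simp: Re_exp abs_if)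
  also have "\<dots> = (\<integral>s. \<nu>0 s * (1 - cos (\<bar>u\<bar> * s)) \<partial>lborel)"
    by (subst integral_levy_measure) auto
  finally have Re: "Re (\<integral>s. 1 - iexp (u * s) \<partial>levy_measure) = \<dots>" .
  have "c * (ln (\<bar>u\<bar> * \<delta>) - 2) \<le> (\<integral>s. \<nu>0 s * (1 - cos (\<bar>u\<bar> * s)) \<partial>lborel)"
  proof (rule ln_le_integral_one_minus_cos)
    have "integrable levy_measure (\<lambda>s. Re (1 - iexp (u * s)))"
      using int by (rule integrable_Re)
    also have "(\<lambda>s. Re (1 - iexp (u * s))) = (\<lambda>s. 1 - cos (\<bar>u\<bar> * s))"
      by (auto simp: Re_exp abs_if)
    finally show "integrable lborel (\<lambda>s. \<nu>0 s * (1 - cos (\<bar>u\<bar> * s)))"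
      by (subst (asm) integrable_levy_measure) auto
    show "0 < \<bar>u\<bar>" "1 \<le> \<bar>u\<bar> * \<delta>"
      using \<delta> by (auto simp: field_simps)
  qed (use c \<nu>0_nonneg in \<open>auto simp: \<nu>0_def\<close>)
  then have "t * (c * (ln (\<bar>u\<bar> * \<delta>) - 2)) \<le> t * Re (\<integral>s. 1 - iexp (u * s) \<partial>levy_measure)"
    unfolding Re using \<open>0 \<le> t\<close> by (rule mult_left_mono)
  then have "norm (char (distr M borel X) u) \<le> exp (- (t * (c * (ln (\<bar>u\<bar> * \<delta>) - 2))))"
    unfolding char by simp
  also have "ln (\<bar>u\<bar> * \<delta>) = ln \<bar>u\<bar> + ln \<delta>"
    using \<delta> by (intro ln_mult_pos) auto
  also have "exp (- (t * (c * (ln \<bar>u\<bar> + ln \<delta> - 2)))) =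
      exp (2 * t * c) * \<delta> powr - (t * c) * \<bar>u\<bar> powr - (t * c)"
    using \<delta> by (auto simp: powr_def algebra_simps simp flip: exp_add)
  finally show ?thesis .
qed

end

section \<open>Bounded continuous densities of the subordinator\<close>

lemma (in subordinator) subordinator_nonneg:
  assumes "0 \<le> t"
  shows "AE \<omega> in M. 0 \<le> S t \<omega>"
  using start_zero nondecreasing_paths
proof eventually_elim
  case (elim \<omega>)
  then show ?case using mono_onD[OF elim(2), of 0 t] assms by simp
qed

theorem proposition1p1:
  fixes M :: "'a measure" and S :: "real \<Rightarrow> 'a \<Rightarrow> real"
    and \<nu> :: "real \<Rightarrow> real" and T0 :: real
  assumes "subordinator M S"
    and "driftless_with_levy_density M S \<nu>"
    and "0 \<le> T0"
    and "Liminf (at_right 0) (\<lambda>x. ereal (x * \<nu> x)) = (if T0 = 0 then \<infinity> else ereal (1 / T0))"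
  shows "\<exists>p :: real \<Rightarrow> real \<Rightarrow> real. \<forall>t>T0.
           law_density M (S t) (p t) \<and>
           continuous_on {0<..} (p t) \<and> bounded (p t ` {0<..})"
proof -
  interpret subordinator M S by fact
  interpret levy_measure_density \<nu>
    using assms(2) by unfold_locales (simp add: driftless_with_levy_density_def)
  have "\<exists>p. law_density M (S t) p \<and> continuous_on {0<..} p \<and> bounded (p ` {0<..})" if t: "T0 < t" for t
  proof -
    have "0 < t" using t assms(3) by simp
    \<comment> \<open>The strict inequality, which also covers an infinite right side, leaves room
      for a \<open>c\<close> with \<open>t * c > 1\<close>, the exponent range in which the power
      tail is integrable.\<close>
    have "ereal (1 / t) < (if T0 = 0 then \<infinity> else ereal (1 / T0))"
      using t assms(3) by (auto simp: field_simps)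
    then obtain c where c: "1 / t < c" "ereal c < Liminf (at_right 0) (\<lambda>x. ereal (x * \<nu> x))"
      unfolding assms(4) using ereal_dense2 by fastforce
    then have "1 < t * c" using \<open>0 < t\<close> by (simp add: field_simps)
    have "0 < c" using c(1) \<open>0 < t\<close> by (meson divide_pos_pos less_trans zero_less_one)
    obtain b where b: "0 < b" "\<And>s. 0 < s \<Longrightarrow> s < b \<Longrightarrow> c < s * \<nu> s"
      using less_LiminfD[OF c(2)] by (auto simp: eventually_at_right_field)
    \<comment> \<open>The lower limit gives the bound only strictly below \<open>b\<close>; halving
      yields an interval closed at its right end.\<close>
    define \<delta> where "\<delta> = b / 2"
    have \<delta>: "0 < \<delta>" "\<And>s. 0 < s \<Longrightarrow> s \<le> \<delta> \<Longrightarrow> c \<le> s * \<nu> s"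
      using b by (auto simp: \<delta>_def less_imp_le)
    have [measurable]: "S t \<in> borel_measurable M"
      using measurable_process \<open>0 < t\<close> by simp
    interpret X: real_distribution "distr M borel (S t)"
      by (rule real_distribution_distr) measurable
    have "integrable lborel (char (distr M borel (S t)))"
    proof (rule integrable_of_powr_decay[where a = "t * c" and K = "1 / \<delta>" and B = 1])
      show "norm (char (distr M borel (S t)) u) \<le>
          exp (2 * t * c) * \<delta> powr - (t * c) * \<bar>u\<bar> powr - (t * c)" if "1 / \<delta> \<le> \<bar>u\<bar>" for u
        using that \<delta> \<open>0 < t\<close> \<open>0 < c\<close> assms(2) subordinator_nonneg
        by (intro norm_char_le prob_space_axioms) (auto simp: driftless_with_levy_density_def)
    qed (use X.cmod_char_le_1 \<open>1 < t * c\<close> \<delta>(1) X.char_measurable in auto)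
    note dens = X.density_of_integrable_char[OF this]
    show ?thesis
    proof (intro exI conjI)
      let ?f = "\<lambda>x. (\<integral>u. Re (iexp (- (u * x)) * char (distr M borel (S t)) u) \<partial>lborel) / (2 * pi)"
      have "?f \<in> borel_measurable borel"
        using dens(2) by (rule borel_measurable_continuous_onI)
      \<comment> \<open>\<open>distributed\<close> refers to \<open>lborel\<close>, characteristic
        functions to \<open>borel\<close>; both have the same measurable sets, so the image measures
        coincide.\<close>
      moreover have "distr M lborel (S t) = distr M borel (S t)"
        by (rule distr_cong) auto
      ultimately show "law_density M (S t) ?f"
        unfolding law_density_def distributed_def
        by (intro conjI allI dens(1) trans[OF _ dens(4)]) auto
      show "continuous_on {0<..} ?f"
        using dens(2) by (rule continuous_on_subset) simp
      show "bounded (?f ` {0<..})"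
        using dens(3) by (rule bounded_subset) auto
    qed
  qed
  then show ?thesis by metis
qed

end
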